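(* Let $n\ge1$ and let $\mathbf a=(a_1,\dots,a_n)$ with $a_i\in\mathbb N$ and $a_1\ne0$, with signature $\operatorname{sgn}(\mathbf a)=(c_1,c_2,\dots,c_k)$. Then the number $v(\mathbf a)$ of vertices of $\mathrm{Flow}_n(\mathbf a)$ is $$v(\mathbf a)=(k+1)^{c_k-1}\prod_{i=1}^{k-1}(i+1)^{c_i}.$$
   Context: $\mathbb N=\{0,1,2,\dots\}$. $K_{n+1}$ is the directed graph on $v_1,\dots,v_{n+1}$ with one edge $(v_i,v_j)$ for each $1\le i<j\le n+1$. $\mathrm{Flow}_n(\mathbf a)\subset\mathbb R^{E(K_{n+1})}$ is the polytope of all functions $f:E(K_{n+1})\to\mathbb R_{\ge0}$ with $\sum_{j>i}f(v_i,v_j)-\sum_{k<i}f(v_k,v_i)=a_i$ for all $1\le i\le n$ (so the netflow at $v_{n+1}$ is $-\sum_i a_i$). Signature: replacing each nonzero entry of $\mathbf a$ by $1$, write the resulting $0$-$1$ vector as the concatenation of $k$ blocks $(1,0,\dots,0)$ of lengths $c_1,\dots,c_k\ge1$, each block consisting of a $1$ followed by $c_i-1$ zeros; then $\operatorname{sgn}(\mathbf a)=(c_1,\dots,c_k)$. *)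

theory Defs
  imports "HOL-Analysis.Analysis" "HOL-Analysis.Finite_Function_Topology"
begin

definition K_edges :: "nat \<Rightarrow> (nat \<times> nat) set" where
  "K_edges m = {(i, j). 1 \<le> i \<and> i < j \<and> j \<le> m}"

text \<open>
  The space of real functions on the edge set is rendered as the subspace of those finitely
  supported functions on pairs that vanish off the (finite) edge set. This makes it a real vector
  space in the library's sense, uniformly in \<open>m\<close>.
\<close>

definition netflow :: "nat \<Rightarrow> (nat \<times> nat \<Rightarrow>\<^sub>0 real) \<Rightarrow> nat \<Rightarrow> real" where
  "netflow m f i =
     (\<Sum>j | (i, j) \<in> K_edges m. Poly_Mapping.lookup f (i, j)) -
     (\<Sum>k | (k, i) \<in> K_edges m. Poly_Mapping.lookup f (k, i))"

definition flow_polytope :: "nat \<Rightarrow> (nat \<Rightarrow> real) \<Rightarrow> (nat \<times> nat \<Rightarrow>\<^sub>0 real) set" where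
  "flow_polytope n a =
     {f. Poly_Mapping.keys f \<subseteq> K_edges (n + 1) \<and>
         (\<forall>e \<in> K_edges (n + 1). 0 \<le> Poly_Mapping.lookup f e) \<and>
         (\<forall>i \<in> {1..n}. netflow (n + 1) f i = a i)}"

definition num_flow_vertices :: "nat \<Rightarrow> (nat \<Rightarrow> real) \<Rightarrow> nat" where
  "num_flow_vertices n a = card {f. f extreme_point_of (flow_polytope n a)}"

definition block_concat :: "nat list \<Rightarrow> nat list" where
  "block_concat c = concat (map (\<lambda>l. 1 # replicate (l - 1) 0) c)"

definition zero_one_vector :: "nat \<Rightarrow> (nat \<Rightarrow> nat) \<Rightarrow> nat list" where
  "zero_one_vector n a = map (\<lambda>i. if a i = 0 then 0 else 1) [1..<n + 1]"

text \<open>The description below is uniquely satisfiable if the first entry is nonzero; see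
  \<open>flow_sgn_ex1\<close>.\<close>

definition flow_sgn :: "nat \<Rightarrow> (nat \<Rightarrow> nat) \<Rightarrow> nat list" where
  "flow_sgn n a = (THE c. (\<forall>l \<in> set c. 1 \<le> l) \<and> zero_one_vector n a = block_concat c)"

lemma block_concat_exists:
  "set xs \<subseteq> {0, 1} \<Longrightarrow> \<exists>m c. (\<forall>l \<in> set c. 1 \<le> l) \<and> xs = replicate m 0 @ block_concat c"
proof (induction xs)
  case Nil
  show ?case by (intro exI[of _ 0] exI[of _ "[]"]) (simp add: block_concat_def)
next
  case (Cons x xs)
  then obtain m c where mc: "\<forall>l \<in> set c. 1 \<le> l" "xs = replicate m 0 @ block_concat c"
    by auto
  show ?case
  proof (cases "x = 0")
    case True
    with mc show ?thesis
      by (intro exI[of _ "Suc m"] exI[of _ c]) simp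
  next
    case False
    with Cons.prems mc show ?thesis
      by (intro exI[of _ 0] exI[of _ "Suc m # c"]) (simp add: block_concat_def)
  qed
qed

lemma replicate_zero_split:
  "replicate m 0 @ (1::nat) # ys = replicate m' 0 @ 1 # ys' \<Longrightarrow> m = m' \<and> ys = ys'"
proof (induction m arbitrary: m')
  case 0
  then show ?case by (cases m') auto
next
  case (Suc m)
  then show ?case by (cases m') auto
qed

lemma block_concat_unique:
  assumes "replicate m 0 @ block_concat c = replicate m' 0 @ block_concat c'"
    and "\<forall>l \<in> set c. 1 \<le> l" "\<forall>l \<in> set c'. 1 \<le> l"
  shows "m = m' \<and> c = c'"
  using assms
proof (induction c arbitrary: m m' c')
  case Nil
  then show ?case
  proof (cases c')
    case Nil
    with Nil.prems show ?thesis by (simp add: block_concat_def)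
  next
    case (Cons l ls)
    with Nil.prems have "1 \<in> set (replicate m (0::nat))"
      by (simp add: block_concat_def)
    then show ?thesis by simp
  qed
next
  case (Cons l ls)
  show ?case
  proof (cases c')
    case Nil
    with Cons.prems have "1 \<in> set (replicate m' (0::nat))"
      by (metis Cons_eq_appendI append.right_neutral block_concat_def concat.simps
          in_set_conv_decomp list.simps(8,9))
    then show ?thesis by simp
  next
    case c': (Cons l' ls')
    have "replicate m 0 @ 1 # (replicate (l - 1) 0 @ block_concat ls) =
          replicate m' 0 @ 1 # (replicate (l' - 1) 0 @ block_concat ls')"
      using Cons.prems(1) by (simp add: c' block_concat_def)
    from replicate_zero_split[OF this]
    have "m = m'" and
      "replicate (l - 1) 0 @ block_concat ls = replicate (l' - 1) 0 @ block_concat ls'"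
      by auto
    moreover from this have "l - 1 = l' - 1 \<and> ls = ls'"
      using Cons.prems c' by (intro Cons.IH) auto
    ultimately show ?thesis
      using Cons.prems c' by auto
  qed
qed

lemma flow_sgn_ex1:
  assumes "1 \<le> n" "a 1 \<noteq> 0"
  shows "\<exists>!c. (\<forall>l \<in> set c. 1 \<le> l) \<and> zero_one_vector n a = block_concat c"
proof -
  have "set (zero_one_vector n a) \<subseteq> {0, 1}"
    by (auto simp: zero_one_vector_def)
  from block_concat_exists[OF this] obtain m c where
    mc: "\<forall>l \<in> set c. 1 \<le> l" "zero_one_vector n a = replicate m 0 @ block_concat c"
    by blast
  have "zero_one_vector n a = 1 # map (\<lambda>i. if a i = 0 then 0 else 1) [2..<n + 1]"
  proof -
    have "[1..<n + 1] = 1 # [2..<n + 1]"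
      using assms(1) upt_conv_Cons[of 1 "n + 1"] by (simp add: numeral_2_eq_2 del: upt_Suc)
    with assms(2) show ?thesis by (simp add: zero_one_vector_def del: upt_Suc)
  qed
  with mc(2) have "m = 0" by (cases m) auto
  with mc show ?thesis
    using block_concat_unique[of 0 _ 0] by (metis append_Nil replicate_0)
qed

end

theory Submission
  imports Defs
begin

text \<open>
  A flow is a vertex of the polytope iff every graph vertex has at most one used outgoing edge, so
  the vertices of the polytope correspond to ways of routing the sources to the sink. Replacing the
  sink by \<open>x\<close> distinct sinks, the number of routings satisfies a recursion in the number of
  graph vertices: the last graph vertex acts as one more sink for the others. This recursion is
  solved by multiples of rising factorials in \<open>x\<close>, and \<open>x = 1\<close> gives the product formula.
\<close>

section \<open>Counting routings\<close>

text \<open>The value 0 encodes that no flow passes through a vertex.\<close>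

definition routings :: "nat \<Rightarrow> nat set \<Rightarrow> nat set \<Rightarrow> (nat \<Rightarrow> nat) set" where
  "routings n A T =
     {g. \<forall>i. if i \<in> {1..n} \<and> (i \<in> A \<or> i \<in> range g) then g i \<in> {i<..n} \<union> T else g i = 0}"

lemma routingsD:
  "g \<in> routings n A T \<Longrightarrow>
    if i \<in> {1..n} \<and> (i \<in> A \<or> i \<in> range g) then g i \<in> {i<..n} \<union> T else g i = 0"
  unfolding routings_def mem_Collect_eq by (rule spec)

lemma routings_0: "routings 0 A T = {\<lambda>_. 0}"
  by (simp add: routings_def fun_eq_iff set_eq_iff)

text \<open>Seen from the first \<open>n\<close> vertices, \<open>Suc n\<close> is just one more
  sink. Resetting its own value to 0 therefore leaves a smaller routing, and what remains is one
  condition on the value at \<open>Suc n\<close>.\<close>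

lemma routings_Suc_iff:
  assumes T: "T \<subseteq> {Suc n<..}"
  shows "g \<in> routings (Suc n) A T \<longleftrightarrow>
    g(Suc n := 0) \<in> routings n A (insert (Suc n) T) \<and>
    (if Suc n \<in> A \<or> Suc n \<in> range (g(Suc n := 0)) then g (Suc n) \<in> T else g (Suc n) = 0)"
    (is "?L \<longleftrightarrow> ?R")
proof -
  let ?h = "g(Suc n := 0)"
  \<comment> \<open>The value at \<open>Suc n\<close> is 0 or a sink beyond \<open>Suc n\<close>, so
    overwriting it cannot change which of the vertices 1 to \<open>Suc n\<close> are hit.\<close>
  have range_iff: "i \<in> range ?h \<longleftrightarrow> i \<in> range g"
    if "i \<in> {1..Suc n}" "g (Suc n) \<in> T \<or> g (Suc n) = 0" for i
  proof -
    have "g (Suc n) \<noteq> i" "i \<noteq> 0" using that T by auto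
    then have "\<forall>j. i = ?h j \<longleftrightarrow> i = g j" by simp
    then show ?thesis by (simp only: image_iff)
  qed
  have targets: "{i<..Suc n} \<union> T = {i<..n} \<union> insert (Suc n) T" if "i \<in> {1..n}" for i
    using that by auto
  show ?thesis
  proof
    assume L: ?L
    note all = routingsD[OF L]
    from all[of "Suc n"] have last: "g (Suc n) \<in> T \<or> g (Suc n) = 0"
      by (auto split: if_splits)
    have "?h \<in> routings n A (insert (Suc n) T)"
      unfolding routings_def mem_Collect_eq
    proof
      fix i
      show "if i \<in> {1..n} \<and> (i \<in> A \<or> i \<in> range ?h)
        then ?h i \<in> {i<..n} \<union> insert (Suc n) T else ?h i = 0"
      proof (cases "i \<in> {1..n}")
        case True
        then show ?thesis
          using all[of i] range_iff[OF _ last, of i] targets[OF True] by auto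
      next
        case False
        then show ?thesis using all[of i] by (auto split: if_splits)
      qed
    qed
    moreover have "if Suc n \<in> A \<or> Suc n \<in> range ?h then g (Suc n) \<in> T else g (Suc n) = 0"
      using all[of "Suc n"] range_iff[OF _ last, of "Suc n"] by (auto split: if_splits)
    ultimately show ?R by blast
  next
    assume R: ?R
    then have last: "g (Suc n) \<in> T \<or> g (Suc n) = 0"
      by (auto split: if_splits)
    note all = routingsD[OF conjunct1[OF R]]
    show ?L
      unfolding routings_def mem_Collect_eq
    proof
      fix i
      consider "i \<in> {1..n}" | "i = Suc n" | "i \<notin> {1..Suc n}" by force
      then show "if i \<in> {1..Suc n} \<and> (i \<in> A \<or> i \<in> range g)
        then g i \<in> {i<..Suc n} \<union> T else g i = 0"
      proof cases
        case 1
        then show ?thesis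
          using all[of i] range_iff[OF _ last, of i] targets[OF 1] by auto
      next
        case 2
        then show ?thesis
          using R range_iff[OF _ last, of "Suc n"] by (auto split: if_splits)
      next
        case 3
        then show ?thesis using all[of i] by (auto split: if_splits)
      qed
    qed
  qed
qed

lemma routings_vanish: "g \<in> routings n A T \<Longrightarrow> n < i \<Longrightarrow> g i = 0"
  using routingsD[of g n A T i] by simp

lemma routings_insert_unused_iff:
  assumes "\<And>i. h i \<noteq> t"
  shows "h \<in> routings n A (insert t T) \<longleftrightarrow> h \<in> routings n A T"
proof -
  have "h i \<in> {i<..n} \<union> insert t T \<longleftrightarrow> h i \<in> {i<..n} \<union> T" for i
    using assms[of i] by auto
  then show ?thesis by (simp only: routings_def mem_Collect_eq)
qed

text \<open>Without \<open>Suc n\<close> among the sinks, every value is 0, at most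
  \<open>n\<close>, or in \<open>T\<close>, hence never \<open>Suc n\<close>. This identifies the
  case in which nothing arrives at \<open>Suc n\<close>.\<close>

lemma routings_avoid_sink:
  assumes "T \<subseteq> {Suc n<..}"
  shows "{h \<in> routings n A (insert (Suc n) T). Suc n \<notin> range h} = routings n A T"
proof -
  have "h i \<noteq> Suc n" if "h \<in> routings n A T" for h i
    using routingsD[OF that, of i] assms by (auto split: if_splits)
  then show ?thesis
    using routings_insert_unused_iff[of _ "Suc n"] by (auto simp: image_iff) metis+
qed

text \<open>A source at \<open>Suc n\<close> is always active and chooses a sink in \<open>T\<close>
  independently of the rest. A non-source chooses one only if some earlier vertex routes to
  it.\<close>

lemma routings_Suc:
  fixes n :: nat and A T :: "nat set"
  assumes T: "T \<subseteq> {Suc n<..}"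
  defines "S \<equiv> routings n A (insert (Suc n) T)"
  shows "Suc n \<in> A \<Longrightarrow>
      routings (Suc n) A T = (\<lambda>(h, t). h(Suc n := t)) ` (S \<times> T)"
    and "Suc n \<notin> A \<Longrightarrow>
      routings (Suc n) A T = routings n A T \<union>
        (\<lambda>(h, t). h(Suc n := t)) ` ({h \<in> S. Suc n \<in> range h} \<times> T)"
proof -
  \<comment> \<open>Routings of the first \<open>n\<close> vertices already vanish at
    \<open>Suc n\<close>.\<close>
  have upd: "h(Suc n := 0) = h" if "h \<in> S" for h
    using routings_vanish[of h n A _ "Suc n"] that by (auto simp: S_def)
  show "routings (Suc n) A T = (\<lambda>(h, t). h(Suc n := t)) ` (S \<times> T)" if "Suc n \<in> A"
  proof (intro set_eqI iffI)
    fix g assume "g \<in> routings (Suc n) A T"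
    then have "(g(Suc n := 0), g (Suc n)) \<in> S \<times> T"
      using that routings_Suc_iff[OF T, of g A] by (auto simp: S_def)
    then show "g \<in> (\<lambda>(h, t). h(Suc n := t)) ` (S \<times> T)"
      by (intro image_eqI) auto
  next
    fix g assume "g \<in> (\<lambda>(h, t). h(Suc n := t)) ` (S \<times> T)"
    then obtain h t where "h \<in> S" "t \<in> T" "g = h(Suc n := t)" by auto
    then show "g \<in> routings (Suc n) A T"
      using that routings_Suc_iff[OF T, of g A] upd[of h] by (auto simp: S_def)
  qed
  show "routings (Suc n) A T = routings n A T \<union>
        (\<lambda>(h, t). h(Suc n := t)) ` ({h \<in> S. Suc n \<in> range h} \<times> T)" (is "_ = ?R") if "Suc n \<notin> A"
  proof (intro set_eqI iffI)
    fix g assume g: "g \<in> routings (Suc n) A T"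
    let ?h = "g(Suc n := 0)"
    from g have S: "?h \<in> S"
      and c: "if Suc n \<in> range ?h then g (Suc n) \<in> T else g (Suc n) = 0"
      using that routings_Suc_iff[OF T, of g A] by (auto simp: S_def)
    show "g \<in> ?R"
    proof (cases "Suc n \<in> range ?h")
      case True
      with S c have "(?h, g (Suc n)) \<in> {h \<in> S. Suc n \<in> range h} \<times> T"
        by (simp only: mem_Sigma_iff mem_Collect_eq)
      then show ?thesis
        by (intro UnI2 image_eqI) auto
    next
      case False
      with c have "?h = g" by auto
      with S False have "g \<in> {h \<in> S. Suc n \<notin> range h}" by simp
      then show ?thesis
        using routings_avoid_sink[OF T, of A] by (simp add: S_def)
    qed
  next
    fix g assume "g \<in> ?R"
    then consider "g \<in> {h \<in> S. Suc n \<notin> range h}"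
      | h t where "h \<in> S" "Suc n \<in> range h" "t \<in> T" "g = h(Suc n := t)"
      using routings_avoid_sink[OF T, of A] by (auto simp: S_def)
    then show "g \<in> routings (Suc n) A T"
    proof cases
      case 1
      then have "g(Suc n := 0) = g" using upd[of g] by simp
      then have "g (Suc n) = 0" by (metis fun_upd_same)
      with 1 \<open>g(Suc n := 0) = g\<close> that show ?thesis
        using routings_Suc_iff[OF T, of g A] by (simp add: S_def)
    next
      case 2
      then have "g(Suc n := 0) = h" using upd[of h] by simp
      with 2 that show ?thesis
        using routings_Suc_iff[OF T, of g A] by (simp add: S_def)
    qed
  qed
qed

lemma inj_on_update_routings:
  "inj_on (\<lambda>(h, t). h(Suc n := t)) (routings n A U \<times> T)"
proof (rule inj_onI, clarify)
  fix h t h' t'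
  assume h: "h \<in> routings n A U" "h' \<in> routings n A U"
    and eq: "h(Suc n := t) = h'(Suc n := t')"
  from eq have "t = t'" by (metis fun_upd_same)
  moreover have "h i = h' i" for i
    using routings_vanish[OF h(1), of i] routings_vanish[OF h(2), of i] fun_cong[OF eq, of i]
    by (cases "i = Suc n") auto
  ultimately show "h = h' \<and> t = t'" by auto
qed

text \<open>A state is the number of sources met so far together with a scalar factor.\<close>

fun scan_step :: "nat \<times> nat \<Rightarrow> nat \<Rightarrow> nat \<times> nat" where
  "scan_step (k, C) x = (if x = 0 then (k, C * (k + 1)) else (k + 1, C))"

text \<open>With \<open>x\<close> sinks the count satisfies \<open>W' x = x * W (x + 1)\<close> when a source is appended
  and \<open>W' x = W x + x * (W (x + 1) - W x)\<close> when a non-source is appended. The rising factorials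
  are carried into each other by the first operator and are eigenvectors of the second.\<close>

lemma card_routings:
  assumes "finite T" "T \<subseteq> {n<..}"
    and "foldl scan_step (0, 1) (map (\<lambda>i. if i \<in> A then 1 else 0) [1..<n + 1]) = (k, C)"
  shows "finite (routings n A T) \<and> card (routings n A T) = C * pochhammer (card T) k"
  using assms
proof (induction n arbitrary: T k C)
  case 0
  then show ?case by (simp add: routings_0)
next
  case (Suc n)
  let ?S = "routings n A (insert (Suc n) T)"
  let ?U = "{h \<in> ?S. Suc n \<in> range h}"
  let ?upd = "\<lambda>(h, t). h(Suc n := t)"
  have T: "T \<subseteq> {Suc n<..}" "finite T" "Suc n \<notin> T" "T \<subseteq> {n<..}"
    using Suc.prems by auto
  obtain k' C' where st:
    "foldl scan_step (0, 1) (map (\<lambda>i. if i \<in> A then 1 else 0) [1..<n + 1]) = (k', C')"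
    by fastforce
  have kC: "(k, C) = scan_step (k', C') (if Suc n \<in> A then 1 else 0)"
    using Suc.prems(3) st by simp
  \<comment> \<open>The induction hypothesis is used for two sink sets: with the additional sink
    \<open>Suc n\<close>, so at argument \<open>card T + 1\<close>, and below with \<open>T\<close>
    itself.\<close>
  have S: "finite ?S" "card ?S = C' * pochhammer (card T + 1) k'"
    using Suc.IH[of "insert (Suc n) T", OF _ _ st] T by auto
  have R: "finite (routings n A T)" "card (routings n A T) = C' * pochhammer (card T) k'"
    using Suc.IH[of T, OF _ _ st] T by auto
  show ?case
  proof (cases "Suc n \<in> A")
    case True
    have "card (routings (Suc n) A T) = card (?S \<times> T)"
      unfolding routings_Suc(1)[OF T(1) True] by (rule card_image[OF inj_on_update_routings])
    also have "\<dots> = C * pochhammer (card T) k"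
      using kC True S(2) by (simp add: card_cartesian_product pochhammer_rec)
    finally show ?thesis
      using S(1) T routings_Suc(1)[OF T(1) True] by simp
  next
    case False
    have inj: "inj_on ?upd (?U \<times> T)"
      by (rule inj_on_subset[OF inj_on_update_routings]) auto
    \<comment> \<open>The routings on the left are 0 at \<open>Suc n\<close>, while the updated ones
      take a value in \<open>T\<close> there, which is positive.\<close>
    have disj: "routings n A T \<inter> ?upd ` (?U \<times> T) = {}"
      using routings_vanish[of _ n A T "Suc n"] T by fastforce
    have "card ?S = card (routings n A T) + card ?U"
    proof -
      have "?S = routings n A T \<union> ?U" "routings n A T \<inter> ?U = {}"
        using routings_avoid_sink[OF T(1), of A] by auto
      then show ?thesis using S(1) R(1) by (metis (no_types, lifting) card_Un_disjoint finite_Un)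
    qed
    \<comment> \<open>The routings that hit \<open>Suc n\<close> are counted by the difference of
      the two counts, stated as a sum to avoid subtraction on naturals.\<close>
    then have U: "C' * pochhammer (card T + 1) k' = C' * pochhammer (card T) k' + card ?U"
      using S R by simp
    have "card (routings (Suc n) A T) = card (routings n A T) + card (?U \<times> T)"
      unfolding routings_Suc(2)[OF T(1) False]
      using R(1) S(1) T(2) disj card_image[OF inj] by (subst card_Un_disjoint) auto
    also have "\<dots> = C' * pochhammer (card T) k' + card ?U * card T"
      using R(2) by (simp add: card_cartesian_product)
    also have "\<dots> = C' * (k' + 1) * pochhammer (card T) k'"
    proof -
      \<comment> \<open>Both sides are the rising factorial of length \<open>k' + 1\<close>, peeled
        at its first or its last factor. This produces the eigenvalue \<open>k' + 1\<close>.\<close>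
      have "card T * pochhammer (card T + 1) k' = pochhammer (card T) k' * (card T + k')"
        using pochhammer_rec[of "card T" k'] pochhammer_Suc[of "card T" k'] by simp
      then have "C' * pochhammer (card T) k' * (card T + k') =
          C' * pochhammer (card T) k' * card T + card ?U * card T"
        using U by (metis (no_types, lifting) distrib_right mult.assoc mult.commute)
      then show ?thesis by (simp add: algebra_simps)
    qed
    finally show ?thesis
      using kC False S(1) R(1) T(2) routings_Suc(2)[OF T(1) False] by simp
  qed
qed

section \<open>Evaluating the recursion on a signature\<close>

lemma foldl_scan_step_zeros: "foldl scan_step (k, C) (replicate m 0) = (k, C * (k + 1) ^ m)"
  by (induction m arbitrary: C) (simp_all add: algebra_simps)

text \<open>The leading 1 of block \<open>i\<close> raises the source count to \<open>i\<close>;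
  each of its \<open>c i - 1\<close> zeros then contributes a factor \<open>i + 1\<close>.\<close>

lemma foldl_scan_step_block_concat:
  "foldl scan_step (0, 1) (block_concat (map c [1..<k + 1])) = (k, \<Prod>i = 1..k. (i + 1) ^ (c i - 1))"
proof (induction k)
  case 0
  then show ?case by (simp add: block_concat_def)
next
  case (Suc k)
  have "block_concat (map c [1..<Suc k + 1]) =
      block_concat (map c [1..<k + 1]) @ 1 # replicate (c (Suc k) - 1) 0"
    by (simp add: block_concat_def)
  then show ?case
    using Suc by (simp add: foldl_scan_step_zeros)
qed

section \<open>Flows driven by a transition matrix\<close>

text \<open>The total amount reaching \<open>i\<close>, from outside and from earlier vertices, when
  vertex \<open>k\<close> sends the fraction \<open>p k j\<close> of what it receives to
  \<open>j\<close>. The recursion terminates because edges increase the index.\<close>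

fun throughput :: "(nat \<Rightarrow> real) \<Rightarrow> (nat \<Rightarrow> nat \<Rightarrow> real) \<Rightarrow> nat \<Rightarrow> real" where
  "throughput a p i = a i + (\<Sum>k\<in>{1..<i}. throughput a p k * p k i)"

declare throughput.simps [simp del]

definition matrix_flow :: "nat \<Rightarrow> (nat \<Rightarrow> real) \<Rightarrow> (nat \<Rightarrow> nat \<Rightarrow> real) \<Rightarrow> (nat \<times> nat \<Rightarrow>\<^sub>0 real)" where
  "matrix_flow n a p = Abs_poly_mapping
     (\<lambda>(i, j). if (i, j) \<in> K_edges (n + 1) then throughput a p i * p i j else 0)"

lemma finite_K_edges: "finite (K_edges m)"
  by (rule finite_subset[of _ "{1..m} \<times> {1..m}"]) (auto simp: K_edges_def)

lemma lookup_matrix_flow: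
  "Poly_Mapping.lookup (matrix_flow n a p) (i, j) =
     (if (i, j) \<in> K_edges (n + 1) then throughput a p i * p i j else 0)"
proof -
  have "finite {e. (\<lambda>(i, j). if (i, j) \<in> K_edges (n + 1) then throughput a p i * p i j else 0) e \<noteq> 0}"
    by (rule finite_subset[OF _ finite_K_edges[of "n + 1"]]) (auto split: if_splits)
  then show ?thesis
    by (simp add: matrix_flow_def)
qed

lemma netflow_eq:
  assumes "i \<in> {1..n}"
  shows "netflow (n + 1) f i =
    (\<Sum>j\<in>{i<..n+1}. Poly_Mapping.lookup f (i, j)) - (\<Sum>k\<in>{1..<i}. Poly_Mapping.lookup f (k, i))"
proof -
  have "{j. (i, j) \<in> K_edges (n + 1)} = {i<..n+1}" "{k. (k, i) \<in> K_edges (n + 1)} = {1..<i}"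
    using assms by (auto simp: K_edges_def)
  then show ?thesis by (simp add: netflow_def)
qed

definition stochastic :: "nat \<Rightarrow> (nat \<Rightarrow> nat \<Rightarrow> real) \<Rightarrow> bool" where
  "stochastic n p \<longleftrightarrow>
     (\<forall>i\<in>{1..n}. (\<forall>j. 0 \<le> p i j) \<and> (\<Sum>j\<in>{i<..n+1}. p i j) = 1)"

lemma throughput_nonneg:
  assumes "\<And>i. i \<in> {1..n} \<Longrightarrow> 0 \<le> a i" "stochastic n p" "i \<in> {1..n}"
  shows "0 \<le> throughput a p i"
  using assms(3)
proof (induction i rule: less_induct)
  case (less i)
  have "0 \<le> throughput a p k * p k i" if "k \<in> {1..<i}" for k
    using less.IH[of k] less.prems that assms(2) by (auto simp: stochastic_def)
  then show ?case
    using assms(1)[OF less.prems]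
    by (subst throughput.simps) (intro add_nonneg_nonneg sum_nonneg)
qed

text \<open>Since rows sum to 1, the outflow of a vertex is its throughput; the inflow is the sum in
  the recursion for the throughput, and the difference is \<open>a i\<close>.\<close>

lemma matrix_flow_in_flow_polytope:
  assumes "\<And>i. i \<in> {1..n} \<Longrightarrow> 0 \<le> a i" "stochastic n p"
  shows "matrix_flow n a p \<in> flow_polytope n a"
proof -
  have "Poly_Mapping.keys (matrix_flow n a p) \<subseteq> K_edges (n + 1)"
    by (auto simp: in_keys_iff lookup_matrix_flow split: if_splits)
  moreover have "0 \<le> Poly_Mapping.lookup (matrix_flow n a p) e" if "e \<in> K_edges (n + 1)" for e
    using that throughput_nonneg[OF assms, where i = "fst e"] assms(2)
    by (cases e) (auto simp: lookup_matrix_flow stochastic_def K_edges_def)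
  moreover have "netflow (n + 1) (matrix_flow n a p) i = a i" if "i \<in> {1..n}" for i
  proof -
    have "(\<Sum>j\<in>{i<..n+1}. Poly_Mapping.lookup (matrix_flow n a p) (i, j)) =
        throughput a p i * (\<Sum>j\<in>{i<..n+1}. p i j)"
      unfolding sum_distrib_left
      by (rule sum.cong) (use that in \<open>auto simp: lookup_matrix_flow K_edges_def\<close>)
    also have "\<dots> = throughput a p i"
      using assms(2) that by (simp add: stochastic_def)
    finally have out: "(\<Sum>j\<in>{i<..n+1}. Poly_Mapping.lookup (matrix_flow n a p) (i, j)) =
        throughput a p i" .
    have "(\<Sum>k\<in>{1..<i}. Poly_Mapping.lookup (matrix_flow n a p) (k, i)) =
        (\<Sum>k\<in>{1..<i}. throughput a p k * p k i)"
      by (rule sum.cong) (use that in \<open>auto simp: lookup_matrix_flow K_edges_def\<close>)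
    with out show ?thesis
      by (simp only: netflow_eq[OF that] throughput.simps[of a p i])
  qed
  ultimately show ?thesis
    by (auto simp: flow_polytope_def)
qed

text \<open>Only rows of earlier vertices enter the recursion. In particular, replacing row
  \<open>i\<close> does not affect the throughput at \<open>i\<close>.\<close>

lemma throughput_cong:
  assumes "\<And>k. k < i \<Longrightarrow> p k = q k"
  shows "throughput a p i = throughput a q i"
  using assms
proof (induction i rule: less_induct)
  case (less i)
  then show ?case
    by (subst (1 2) throughput.simps) (auto intro!: sum.cong)
qed

text \<open>Since the graph is acyclic, the throughput is affine in each single row of the matrix.\<close>

lemma throughput_row_affine:
  fixes s :: real
  shows "throughput a (p(i := \<lambda>j. s * q j + (1 - s) * r j)) m =
    s * throughput a (p(i := q)) m + (1 - s) * throughput a (p(i := r)) m"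
proof (induction m rule: less_induct)
  case (less m)
  let ?P = "p(i := \<lambda>j. s * q j + (1 - s) * r j)"
  let ?Q = "p(i := q)" and ?R = "p(i := r)"
  have "throughput a ?P k * ?P k m =
      s * (throughput a ?Q k * ?Q k m) + (1 - s) * (throughput a ?R k * ?R k m)"
    if "k \<in> {1..<m}" for k
  proof (cases "k = i")
    case True
    have "throughput a ?P k = throughput a p k" "throughput a ?Q k = throughput a p k"
      "throughput a ?R k = throughput a p k"
      using True by (auto intro!: throughput_cong)
    then show ?thesis using True by (simp add: algebra_simps)
  next
    case False
    have "throughput a ?P k = s * throughput a ?Q k + (1 - s) * throughput a ?R k"
      using that by (intro less.IH) simp
    moreover have "?P k m = p k m" "?Q k m = p k m" "?R k m = p k m"
      using False by auto
    ultimately show ?thesis by (simp only: distrib_right mult.assoc)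
  qed
  then have "(\<Sum>k\<in>{1..<m}. throughput a ?P k * ?P k m) =
      s * (\<Sum>k\<in>{1..<m}. throughput a ?Q k * ?Q k m)
      + (1 - s) * (\<Sum>k\<in>{1..<m}. throughput a ?R k * ?R k m)"
    by (simp add: sum.distrib sum_distrib_left)
  \<comment> \<open>The constant supply at \<open>m\<close> splits in the same way because the
    weights \<open>s\<close> and \<open>1 - s\<close> add up to 1.\<close>
  moreover have "b + u = s * (b + v) + (1 - s) * (b + w)" if "u = s * v + (1 - s) * w" for b u v w
    using that by (simp add: algebra_simps)
  ultimately show ?case
    unfolding throughput.simps[of a _ m] by blast
qed

lemma lookup_scaleR:
  fixes f :: "'b \<Rightarrow>\<^sub>0 real"
  shows "Poly_Mapping.lookup (c *\<^sub>R f) e = c * Poly_Mapping.lookup f e"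
proof -
  have "finite {e. c * Poly_Mapping.lookup f e \<noteq> 0}"
    by (rule finite_subset[OF _ finite_keys[of f]]) (auto simp: in_keys_iff)
  then show ?thesis by (simp add: scaleR_poly_mapping_def)
qed

text \<open>On edges leaving \<open>i\<close> the throughput is fixed and the row varies affinely;
  on all other edges the row is fixed and the throughput varies affinely. No quadratic terms in
  \<open>s\<close> arise.\<close>

lemma matrix_flow_row_affine:
  fixes s :: real
  shows "matrix_flow n a (p(i := \<lambda>j. s * q j + (1 - s) * r j)) =
    s *\<^sub>R matrix_flow n a (p(i := q)) + (1 - s) *\<^sub>R matrix_flow n a (p(i := r))"
proof (rule poly_mapping_eqI, clarify)
  fix m j
  show "Poly_Mapping.lookup (matrix_flow n a (p(i := \<lambda>j. s * q j + (1 - s) * r j))) (m, j) =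
    Poly_Mapping.lookup
      (s *\<^sub>R matrix_flow n a (p(i := q)) + (1 - s) *\<^sub>R matrix_flow n a (p(i := r))) (m, j)"
  proof (cases "m = i")
    case True
    have "throughput a (p(i := f)) i = throughput a p i" for f
      by (rule throughput_cong) auto
    with True show ?thesis
      by (simp only: lookup_matrix_flow lookup_add lookup_scaleR) (auto simp: algebra_simps)
  next
    case False
    then show ?thesis
      by (simp only: lookup_matrix_flow lookup_add lookup_scaleR throughput_row_affine)
        (auto simp: algebra_simps)
  qed
qed

section \<open>Recovering a transition matrix from a flow\<close>

lemma flow_polytopeD:
  assumes "f \<in> flow_polytope n a"
  shows "Poly_Mapping.lookup f (i, j) \<noteq> 0 \<Longrightarrow> (i, j) \<in> K_edges (n + 1)"
    and "0 \<le> Poly_Mapping.lookup f (i, j)"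
    and "i \<in> {1..n} \<Longrightarrow> (\<Sum>j\<in>{i<..n+1}. Poly_Mapping.lookup f (i, j)) =
      a i + (\<Sum>k\<in>{1..<i}. Poly_Mapping.lookup f (k, i))"
proof -
  show *: "(i, j) \<in> K_edges (n + 1)" if "Poly_Mapping.lookup f (i, j) \<noteq> 0"
    using that assms by (auto simp: flow_polytope_def in_keys_iff)
  show "0 \<le> Poly_Mapping.lookup f (i, j)"
    using * assms by (cases "(i, j) \<in> K_edges (n + 1)") (fastforce simp: flow_polytope_def)+
  show "(\<Sum>j\<in>{i<..n+1}. Poly_Mapping.lookup f (i, j)) =
      a i + (\<Sum>k\<in>{1..<i}. Poly_Mapping.lookup f (k, i))" if "i \<in> {1..n}"
    using netflow_eq[OF that, of f] assms that by (simp add: flow_polytope_def)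
qed

text \<open>Dividing each edge value by the total outflow of its tail gives the matrix; flow
  conservation then shows inductively that throughput and total outflow agree.\<close>

lemma flow_is_matrix_flow:
  assumes f: "f \<in> flow_polytope n a"
  obtains p where "stochastic n p" "matrix_flow n a p = f"
proof -
  define w where "w i = (\<Sum>j\<in>{i<..n+1}. Poly_Mapping.lookup f (i, j))" for i
  \<comment> \<open>A vertex without outflow gets the unit row pointing to the sink
    \<open>n + 1\<close>, so that its row also sums to 1.\<close>
  define p where "p i j = (if w i = 0 then (if j = n + 1 then 1 else 0)
      else Poly_Mapping.lookup f (i, j) / w i)" for i j
  have w_nonneg: "0 \<le> w i" for i
    unfolding w_def by (intro sum_nonneg flow_polytopeD(2)[OF f])
  have "stochastic n p"
    unfolding stochastic_def
  proof (intro ballI conjI allI)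
    fix i j assume "i \<in> {1..n}"
    show "0 \<le> p i j"
      using w_nonneg flow_polytopeD(2)[OF f] by (simp add: p_def)
  next
    fix i assume i: "i \<in> {1..n}"
    show "(\<Sum>j\<in>{i<..n+1}. p i j) = 1"
    proof (cases "w i = 0")
      case True
      then show ?thesis using i by (simp add: p_def)
    next
      case False
      then have "(\<Sum>j\<in>{i<..n+1}. p i j) = (\<Sum>j\<in>{i<..n+1}. Poly_Mapping.lookup f (i, j) / w i)"
        by (simp add: p_def)
      also have "\<dots> = w i / w i"
        unfolding sum_divide_distrib[symmetric] by (simp add: w_def)
      finally have "(\<Sum>j\<in>{i<..n+1}. p i j) = w i / w i" .
      with False show ?thesis by simp
    qed
  qed
  \<comment> \<open>If the outflow is zero, nonnegativity forces every outgoing value to be zero, so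
    the default row is harmless.\<close>
  moreover have edge: "w i * p i j = Poly_Mapping.lookup f (i, j)" if "(i, j) \<in> K_edges (n + 1)" for i j
  proof (cases "w i = 0")
    case True
    then have "\<forall>j\<in>{i<..n+1}. Poly_Mapping.lookup f (i, j) = 0"
      unfolding w_def by (subst (asm) sum_nonneg_eq_0_iff) (auto intro: flow_polytopeD(2)[OF f])
    with True that show ?thesis by (auto simp: K_edges_def)
  qed (simp add: p_def)
  have thr: "throughput a p i = w i" if "i \<in> {1..n}" for i
    using that
  proof (induction i rule: less_induct)
    case (less i)
    have "throughput a p k * p k i = Poly_Mapping.lookup f (k, i)" if "k \<in> {1..<i}" for k
      using less that edge[of k i] by (auto simp: K_edges_def)
    then have "throughput a p i = a i + (\<Sum>k\<in>{1..<i}. Poly_Mapping.lookup f (k, i))"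
      by (subst throughput.simps) simp
    also have "\<dots> = w i"
      using flow_polytopeD(3)[OF f less.prems] by (simp add: w_def)
    finally show ?case .
  qed
  have "matrix_flow n a p = f"
  proof (rule poly_mapping_eqI, clarify)
    fix i j
    show "Poly_Mapping.lookup (matrix_flow n a p) (i, j) = Poly_Mapping.lookup f (i, j)"
    proof (cases "(i, j) \<in> K_edges (n + 1)")
      case True
      then have "i \<in> {1..n}" by (auto simp: K_edges_def)
      with True show ?thesis by (simp add: lookup_matrix_flow thr edge)
    next
      case False
      then show ?thesis using flow_polytopeD(1)[OF f] by (auto simp: lookup_matrix_flow)
    qed
  qed
  ultimately show ?thesis using that by blast
qed

section \<open>Vertices of the flow polytope\<close>

definition single_out :: "(nat \<times> nat \<Rightarrow>\<^sub>0 real) \<Rightarrow> bool" where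
  "single_out f \<longleftrightarrow> (\<forall>i j j'. Poly_Mapping.lookup f (i, j) \<noteq> 0 \<longrightarrow>
     Poly_Mapping.lookup f (i, j') \<noteq> 0 \<longrightarrow> j = j')"

text \<open>A vertex with two used outgoing edges exhibits the flow as a proper convex combination:
  split its row of the transition matrix into a unit vector and the normalized remainder.\<close>

lemma extreme_point_single_out:
  assumes a: "\<And>i. i \<in> {1..n} \<Longrightarrow> 0 \<le> a i" and ext: "f extreme_point_of flow_polytope n a"
  shows "single_out f"
  unfolding single_out_def
proof (intro allI impI, rule ccontr)
  fix i j j'
  assume fj: "Poly_Mapping.lookup f (i, j) \<noteq> 0" "Poly_Mapping.lookup f (i, j') \<noteq> 0" and ne: "j \<noteq> j'"
  have f: "f \<in> flow_polytope n a" using ext by (simp add: extreme_point_of_def)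
  then obtain p where p: "stochastic n p" "matrix_flow n a p = f"
    by (rule flow_is_matrix_flow)
  have edges: "(i, j) \<in> K_edges (n + 1)" "(i, j') \<in> K_edges (n + 1)"
    using fj flow_polytopeD(1)[OF f] by auto
  then have i: "i \<in> {1..n}" and j: "j \<in> {i<..n+1}" "j' \<in> {i<..n+1}"
    by (auto simp: K_edges_def)
  have nz: "throughput a p i \<noteq> 0" "p i j \<noteq> 0" "p i j' \<noteq> 0"
    using fj edges by (auto simp: p(2)[symmetric] lookup_matrix_flow)
  define s where "s = p i j"
  define q r where "q l = (if l = j then 1 else 0 :: real)"
    and "r l = (if l = j then 0 else p i l / (1 - s))" for l
  have row: "\<And>l. 0 \<le> p i l" "(\<Sum>l\<in>{i<..n+1}. p i l) = 1"
    using p(1) i by (auto simp: stochastic_def)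
  have rest: "(\<Sum>l\<in>{i<..n+1} - {j}. p i l) = 1 - s"
    using row(2) j(1) by (simp add: sum_diff1 s_def)
  \<comment> \<open>The second used edge keeps the remainder positive, hence \<open>s < 1\<close>,
    and the remainder can be normalized by \<open>1 - s\<close>.\<close>
  have "p i j' \<le> (\<Sum>l\<in>{i<..n+1} - {j}. p i l)"
    using j ne row(1) by (intro member_le_sum) auto
  then have s: "0 < s" "s < 1"
    using nz row(1)[of j] row(1)[of j'] rest by (auto simp: s_def)
  have r_sum: "(\<Sum>l\<in>{i<..n+1}. r l) = 1"
  proof -
    have "(\<Sum>l\<in>{i<..n+1}. r l) = (\<Sum>l\<in>{i<..n+1} - {j}. r l)"
      using j(1) by (subst sum.remove[of _ j]) (auto simp: r_def)
    also have "\<dots> = (\<Sum>l\<in>{i<..n+1} - {j}. p i l / (1 - s))"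
      by (rule sum.cong) (auto simp: r_def)
    also have "\<dots> = 1"
      using rest s by (simp add: sum_divide_distrib[symmetric])
    finally show ?thesis .
  qed
  have st: "stochastic n (p(i := q))" "stochastic n (p(i := r))"
    using p(1) j(1) r_sum s row(1) by (auto simp: stochastic_def q_def r_def)
  have "p i = (\<lambda>l. s * q l + (1 - s) * r l)"
    using s by (auto simp: q_def r_def s_def)
  then have "p = p(i := \<lambda>l. s * q l + (1 - s) * r l)"
    by (metis fun_upd_triv)
  then have f_eq: "f = s *\<^sub>R matrix_flow n a (p(i := q)) + (1 - s) *\<^sub>R matrix_flow n a (p(i := r))"
    using p(2) matrix_flow_row_affine by metis
  have "throughput a (p(i := h)) i = throughput a p i" for h
    by (rule throughput_cong) auto
  \<comment> \<open>The two endpoints are told apart by the edge to \<open>j'\<close>: the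
    throughput at \<open>i\<close> is the same nonzero number in both, but only \<open>r\<close> is
    nonzero at \<open>j'\<close>.\<close>
  then have "Poly_Mapping.lookup (matrix_flow n a (p(i := q))) (i, j') = 0"
    "Poly_Mapping.lookup (matrix_flow n a (p(i := r))) (i, j') \<noteq> 0"
    using edges ne nz s by (auto simp: lookup_matrix_flow q_def r_def)
  then have "matrix_flow n a (p(i := q)) \<noteq> matrix_flow n a (p(i := r))" by metis
  then have "f \<in> open_segment (matrix_flow n a (p(i := q))) (matrix_flow n a (p(i := r)))"
    unfolding in_segment using s f_eq
    by (intro conjI exI[of _ "1 - s"]) auto
  moreover have "matrix_flow n a (p(i := q)) \<in> flow_polytope n a"
    "matrix_flow n a (p(i := r)) \<in> flow_polytope n a"
    using matrix_flow_in_flow_polytope[OF a] st by auto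
  ultimately show False
    using ext by (auto simp: extreme_point_of_def)
qed

text \<open>Along the vertex order, the inflow at \<open>i\<close> is determined by earlier
  vertices; conservation then fixes the outflow, all of which runs along the single admissible edge
  to \<open>g i\<close>.\<close>

lemma flow_unique:
  assumes x: "x \<in> flow_polytope n a" and y: "y \<in> flow_polytope n a"
    and supp: "\<And>i j. j \<noteq> g i \<Longrightarrow> Poly_Mapping.lookup x (i, j) = 0 \<and> Poly_Mapping.lookup y (i, j) = 0"
  shows "x = y"
proof -
  have "\<forall>j. Poly_Mapping.lookup x (i, j) = Poly_Mapping.lookup y (i, j)" for i
  proof (induction i rule: less_induct)
    case (less i)
    show ?case
    proof
      fix j
      show "Poly_Mapping.lookup x (i, j) = Poly_Mapping.lookup y (i, j)"
      proof (cases "(i, j) \<in> K_edges (n + 1) \<and> j = g i")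
        case False
        then show ?thesis
          using supp[of j i] flow_polytopeD(1)[OF x] flow_polytopeD(1)[OF y] by metis
      next
        case True
        then have i: "i \<in> {1..n}" and j: "j \<in> {i<..n+1}" "j = g i" by (auto simp: K_edges_def)
        have single: "(\<Sum>l\<in>{i<..n+1}. Poly_Mapping.lookup z (i, l)) = Poly_Mapping.lookup z (i, j)"
          if "z = x \<or> z = y" for z
          using sum.remove[OF _ j(1), of "\<lambda>l. Poly_Mapping.lookup z (i, l)"] that supp j(2)
          by (auto intro!: sum.neutral)
        have "(\<Sum>k\<in>{1..<i}. Poly_Mapping.lookup x (k, i)) = (\<Sum>k\<in>{1..<i}. Poly_Mapping.lookup y (k, i))"
          using less.IH by (intro sum.cong) auto
        then show ?thesis
          using flow_polytopeD(3)[OF x i] flow_polytopeD(3)[OF y i] single[of x] single[of y] by simp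
      qed
    qed
  qed
  then show ?thesis by (intro poly_mapping_eqI) auto
qed

section \<open>Bijection between vertices of the polytope and routings\<close>

text \<open>The default 0 for a vertex without outflow matches the encoding in
  \<open>routings\<close>; 0 is never the head of an edge.\<close>

definition out_target :: "(nat \<times> nat \<Rightarrow>\<^sub>0 real) \<Rightarrow> nat \<Rightarrow> nat" where
  "out_target f i =
     (if \<exists>j. Poly_Mapping.lookup f (i, j) \<noteq> 0 then THE j. Poly_Mapping.lookup f (i, j) \<noteq> 0 else 0)"

lemma lookup_nonzero_iff_out_target:
  assumes "f \<in> flow_polytope n a" "single_out f"
  shows "Poly_Mapping.lookup f (i, j) \<noteq> 0 \<longleftrightarrow> out_target f i = j \<and> j \<noteq> 0"
proof (cases "\<exists>j. Poly_Mapping.lookup f (i, j) \<noteq> 0")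
  case True
  then obtain l where l: "Poly_Mapping.lookup f (i, l) \<noteq> 0" by blast
  then have uniq: "Poly_Mapping.lookup f (i, j) \<noteq> 0 \<longleftrightarrow> j = l" for j
    using assms(2) by (auto simp: single_out_def)
  then have "out_target f i = l"
    by (simp add: out_target_def)
  moreover have "l \<noteq> 0"
    using flow_polytopeD(1)[OF assms(1) l] by (auto simp: K_edges_def)
  ultimately show ?thesis using uniq by auto
qed (auto simp: out_target_def)

lemma out_target_eqI:
  assumes "\<And>i j. Poly_Mapping.lookup f (i, j) \<noteq> 0 \<longleftrightarrow> g i = j \<and> j \<noteq> 0"
  shows "out_target f = g"
proof
  fix i
  show "out_target f i = g i"
    unfolding out_target_def using assms[of i] by (cases "g i = 0") auto
qed

text \<open>By nonnegativity, the endpoints of an open segment through \<open>f\<close> vanish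
  wherever \<open>f\<close> does. Both then live on the same one edge per vertex, so
  \<open>flow_unique\<close> makes them equal.\<close>

lemma single_out_extreme_point:
  assumes f: "f \<in> flow_polytope n a" and single: "single_out f"
  shows "f extreme_point_of flow_polytope n a"
  unfolding extreme_point_of_def
proof (intro conjI ballI notI)
  fix x y assume x: "x \<in> flow_polytope n a" and y: "y \<in> flow_polytope n a"
    and seg: "f \<in> open_segment x y"
  from seg obtain u where u: "x \<noteq> y" "0 < u" "u < 1" "f = (1 - u) *\<^sub>R x + u *\<^sub>R y"
    by (auto simp: in_segment)
  have "Poly_Mapping.lookup x (i, j) = 0 \<and> Poly_Mapping.lookup y (i, j) = 0"
    if "j \<noteq> out_target f i" for i j
  proof -
    have "0 = (1 - u) * Poly_Mapping.lookup x (i, j) + u * Poly_Mapping.lookup y (i, j)"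
      using lookup_nonzero_iff_out_target[OF f single, of i j] that u(4)
      by (simp add: lookup_add lookup_scaleR)
    moreover have "0 \<le> (1 - u) * Poly_Mapping.lookup x (i, j)" "0 \<le> u * Poly_Mapping.lookup y (i, j)"
      using u flow_polytopeD(2)[OF x] flow_polytopeD(2)[OF y] by auto
    ultimately have "(1 - u) * Poly_Mapping.lookup x (i, j) = 0" "u * Poly_Mapping.lookup y (i, j) = 0"
      by linarith+
    with u show ?thesis by simp
  qed
  then have "x = y" by (rule flow_unique[OF x y])
  with u(1) show False by simp
qed (rule f)

text \<open>Outflow equals supply plus inflow, and both summands are nonnegative. Hence a vertex has
  outflow exactly if it is a source or the target of another vertex.\<close>

lemma out_target_in_routings:
  assumes a: "\<And>i. i \<in> {1..n} \<Longrightarrow> 0 \<le> a i"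
    and f: "f \<in> flow_polytope n a" and single: "single_out f"
  shows "out_target f \<in> routings n {i. a i \<noteq> 0} {n + 1}"
  unfolding routings_def mem_Collect_eq
proof
  fix i
  note iff = lookup_nonzero_iff_out_target[OF f single]
  have edge: "(i, out_target f i) \<in> K_edges (n + 1)" if "out_target f i \<noteq> 0" for i
    using that iff[of i "out_target f i"] flow_polytopeD(1)[OF f] by blast
  show "if i \<in> {1..n} \<and> (a i \<noteq> 0 \<or> i \<in> range (out_target f))
      then out_target f i \<in> {i<..n} \<union> {n + 1} else out_target f i = 0"
  proof (cases "i \<in> {1..n}")
    case False
    then show ?thesis
      using edge[of i] by (cases "out_target f i = 0") (auto simp: K_edges_def)
  next
    case i: True
    have bal: "(\<Sum>j\<in>{i<..n+1}. Poly_Mapping.lookup f (i, j)) =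
        a i + (\<Sum>k\<in>{1..<i}. Poly_Mapping.lookup f (k, i))"
      by (rule flow_polytopeD(3)[OF f i])
    have in_nonneg: "0 \<le> (\<Sum>k\<in>{1..<i}. Poly_Mapping.lookup f (k, i))"
      by (intro sum_nonneg flow_polytopeD(2)[OF f])
    have in_iff: "(\<Sum>k\<in>{1..<i}. Poly_Mapping.lookup f (k, i)) = 0 \<longleftrightarrow> i \<notin> range (out_target f)"
    proof -
      have "(\<Sum>k\<in>{1..<i}. Poly_Mapping.lookup f (k, i)) = 0 \<longleftrightarrow>
          (\<forall>k\<in>{1..<i}. Poly_Mapping.lookup f (k, i) = 0)"
        by (rule sum_nonneg_eq_0_iff) (auto intro: flow_polytopeD(2)[OF f])
      also have "\<dots> \<longleftrightarrow> (\<forall>k\<in>{1..<i}. out_target f k \<noteq> i)"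
        using iff[of _ i] i by auto
      \<comment> \<open>Any vertex with target \<open>i\<close> is the tail of an edge into
        \<open>i\<close>, so it lies in \<open>{1..<i}\<close> anyway.\<close>
      also have "\<dots> \<longleftrightarrow> (\<forall>k. out_target f k \<noteq> i)"
        using edge i by (fastforce simp: K_edges_def)
      finally show ?thesis by auto
    qed
    have out_iff: "(\<Sum>j\<in>{i<..n+1}. Poly_Mapping.lookup f (i, j)) = 0 \<longleftrightarrow> out_target f i = 0"
    proof -
      have "(\<Sum>j\<in>{i<..n+1}. Poly_Mapping.lookup f (i, j)) = 0 \<longleftrightarrow>
          (\<forall>j\<in>{i<..n+1}. Poly_Mapping.lookup f (i, j) = 0)"
        by (rule sum_nonneg_eq_0_iff) (auto intro: flow_polytopeD(2)[OF f])
      also have "\<dots> \<longleftrightarrow> (\<forall>j\<in>{i<..n+1}. out_target f i \<noteq> j)"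
        using iff[of i] by (intro ball_cong refl) (metis greaterThanAtMost_iff less_nat_zero_code)
      also have "\<dots> \<longleftrightarrow> out_target f i = 0"
        using edge[of i] by (cases "out_target f i = 0") (auto simp: K_edges_def)
      finally show ?thesis .
    qed
    have "out_target f i = 0 \<longleftrightarrow> a i = 0 \<and> i \<notin> range (out_target f)"
      using bal in_nonneg a[OF i] in_iff out_iff by linarith
    then show ?thesis
      using i edge[of i] by (auto simp: K_edges_def)
  qed
qed

text \<open>The flow is the one driven by unit rows pointing at the targets prescribed by
  \<open>g\<close>; its throughput is nonzero exactly at the vertices where \<open>g\<close> is
  nonzero.\<close>

lemma routing_realized:
  assumes a: "\<And>i. i \<in> {1..n} \<Longrightarrow> 0 \<le> a i" and g: "g \<in> routings n {i. a i \<noteq> 0} {n + 1}"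
  obtains f where "f \<in> flow_polytope n a" "single_out f" "out_target f = g"
proof -
  \<comment> \<open>Inactive vertices are pointed at the sink only to make the matrix stochastic;
    their throughput will turn out to be 0.\<close>
  define p where "p i j = (if (if g i = 0 then n + 1 else g i) = j then 1 else 0 :: real)" for i j
  have g_props: "if i \<in> {1..n} \<and> (a i \<noteq> 0 \<or> i \<in> range g)
      then g i \<in> {i<..n} \<union> {n + 1} else g i = 0" for i
    using routingsD[OF g, of i] by simp
  have g_edge: "(i, g i) \<in> K_edges (n + 1)" if "g i \<noteq> 0" for i
    using that g_props[of i] by (auto simp: K_edges_def split: if_splits)
  have st: "stochastic n p"
    unfolding stochastic_def
  proof (intro ballI conjI allI)
    fix i assume i: "i \<in> {1..n}"
    show "(\<Sum>j\<in>{i<..n+1}. p i j) = 1"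
      unfolding p_def using g_edge[of i] i by (subst sum.delta') (auto simp: K_edges_def)
  qed (simp add: p_def)
  have thr: "throughput a p i \<noteq> 0 \<longleftrightarrow> g i \<noteq> 0" if "i \<in> {1..n}" for i
    using that
  proof (induction i rule: less_induct)
    case (less i)
    have nonneg: "0 \<le> throughput a p k * p k i" if "k \<in> {1..<i}" for k
      using throughput_nonneg[OF a st, where i = k] st less.prems that by (auto simp: stochastic_def)
    have "(\<Sum>k\<in>{1..<i}. throughput a p k * p k i) = 0 \<longleftrightarrow>
        (\<forall>k\<in>{1..<i}. throughput a p k * p k i = 0)"
      using nonneg by (intro sum_nonneg_eq_0_iff) auto
    also have "\<dots> \<longleftrightarrow> (\<forall>k\<in>{1..<i}. g k \<noteq> i)"
    proof (rule ball_cong[OF refl])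
      fix k assume k: "k \<in> {1..<i}"
      then have "throughput a p k \<noteq> 0 \<longleftrightarrow> g k \<noteq> 0"
        using less.IH[of k] less.prems by simp
      moreover have "p k i = 0 \<longleftrightarrow> g k \<noteq> i" if "g k \<noteq> 0"
        using that by (simp add: p_def)
      ultimately show "throughput a p k * p k i = 0 \<longleftrightarrow> g k \<noteq> i"
        using k by (cases "g k = 0") auto
    qed
    also have "\<dots> \<longleftrightarrow> i \<notin> range g"
      using g_edge less.prems by (fastforce simp: K_edges_def)
    finally have "(\<Sum>k\<in>{1..<i}. throughput a p k * p k i) = 0 \<longleftrightarrow> i \<notin> range g" .
    moreover have "0 \<le> (\<Sum>k\<in>{1..<i}. throughput a p k * p k i)"
      using nonneg by (rule sum_nonneg)
    ultimately have "throughput a p i = 0 \<longleftrightarrow> a i = 0 \<and> i \<notin> range g"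
      using a[OF less.prems] by (subst throughput.simps) linarith
    then show ?case
      using g_props[of i] less.prems by auto
  qed
  let ?f = "matrix_flow n a p"
  have supp: "Poly_Mapping.lookup ?f (i, j) \<noteq> 0 \<longleftrightarrow> g i = j \<and> j \<noteq> 0" for i j
  proof (cases "(i, j) \<in> K_edges (n + 1)")
    case True
    then have "i \<in> {1..n}" "j \<noteq> 0" by (auto simp: K_edges_def)
    with True thr[of i] show ?thesis by (auto simp: lookup_matrix_flow p_def)
  next
    case False
    then show ?thesis using g_edge[of i] by (auto simp: lookup_matrix_flow)
  qed
  show ?thesis
  proof (rule that)
    show "?f \<in> flow_polytope n a" by (rule matrix_flow_in_flow_polytope[OF a st])
    show "single_out ?f" unfolding single_out_def using supp by metis
    show "out_target ?f = g" by (rule out_target_eqI[OF supp])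
  qed
qed

text \<open>The bijection is \<open>out_target\<close>: it is injective since the targets determine
  the support and thereby the flow, and surjective by \<open>routing_realized\<close>.\<close>

lemma num_flow_vertices_eq_card_routings:
  assumes a: "\<And>i. i \<in> {1..n} \<Longrightarrow> 0 \<le> a i"
  shows "num_flow_vertices n a = card (routings n {i. a i \<noteq> 0} {n + 1})"
proof -
  have ext: "{f. f extreme_point_of flow_polytope n a} = {f \<in> flow_polytope n a. single_out f}"
    using extreme_point_single_out[OF a] single_out_extreme_point
    by (auto simp: extreme_point_of_def)
  have "bij_betw out_target {f \<in> flow_polytope n a. single_out f} (routings n {i. a i \<noteq> 0} {n + 1})"
    unfolding bij_betw_def
  proof (intro conjI inj_onI)
    fix x y
    assume "x \<in> {f \<in> flow_polytope n a. single_out f}" "y \<in> {f \<in> flow_polytope n a. single_out f}"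
      and eq: "out_target x = out_target y"
    then have x: "x \<in> flow_polytope n a" "single_out x" and y: "y \<in> flow_polytope n a" "single_out y"
      by auto
    show "x = y"
    proof (rule flow_unique[OF x(1) y(1)])
      fix i j assume "j \<noteq> out_target x i"
      then show "Poly_Mapping.lookup x (i, j) = 0 \<and> Poly_Mapping.lookup y (i, j) = 0"
        using lookup_nonzero_iff_out_target[OF x, of i j]
          lookup_nonzero_iff_out_target[OF y, of i j] eq by auto
    qed
  next
    show "out_target ` {f \<in> flow_polytope n a. single_out f} = routings n {i. a i \<noteq> 0} {n + 1}"
    proof (intro set_eqI iffI)
      fix g assume "g \<in> out_target ` {f \<in> flow_polytope n a. single_out f}"
      then show "g \<in> routings n {i. a i \<noteq> 0} {n + 1}"
        using out_target_in_routings[OF a] by auto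
    next
      fix g assume "g \<in> routings n {i. a i \<noteq> 0} {n + 1}"
      with a obtain f where "f \<in> flow_polytope n a" "single_out f" "out_target f = g"
        by (rule routing_realized)
      then show "g \<in> out_target ` {f \<in> flow_polytope n a. single_out f}" by auto
    qed
  qed
  then show ?thesis
    unfolding num_flow_vertices_def ext by (rule bij_betw_same_card)
qed

section \<open>The product formula\<close>

text \<open>Writing \<open>fact k\<close> as the product of \<open>i + 1\<close> over
  \<open>i\<close> from 1 to \<open>k - 1\<close> supplies the missing factor of every block but the
  last.\<close>

lemma block_product:
  assumes "1 \<le> k" "\<And>i. i \<in> {1..k} \<Longrightarrow> 1 \<le> c i"
  shows "(\<Prod>i = 1..k. (i + 1) ^ (c i - 1)) * fact k =
    (k + 1) ^ (c k - 1) * (\<Prod>i = 1..k - 1. (i + 1) ^ c i :: nat)"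
proof -
  obtain m where k: "k = Suc m" using assms(1) by (cases k) auto
  have "(i + 1) ^ c i = (i + 1) ^ (c i - 1) * (i + 1)" if "i \<in> {1..m}" for i
    using assms(2)[of i] that k by (cases "c i") auto
  then have "(\<Prod>i = 1..m. (i + 1) ^ c i) = (\<Prod>i = 1..m. (i + 1) ^ (c i - 1) * (i + 1))"
    by (rule prod.cong[OF refl])
  also have "\<dots> = (\<Prod>i = 1..m. (i + 1) ^ (c i - 1)) * (\<Prod>i = 1..m. i + 1)"
    by (rule prod.distrib)
  also have "(\<Prod>i = 1..m. i + 1) = (fact k :: nat)"
    unfolding k by (induction m) auto
  finally show ?thesis
    by (simp add: k mult_ac)
qed

theorem proposition5p3:
  fixes n k :: nat and a :: "nat \<Rightarrow> nat" and c :: "nat \<Rightarrow> nat"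
  assumes "n \<ge> 1"
    and "a 1 \<noteq> 0"
    and "flow_sgn n a = map c [1..<k + 1]"
  shows "num_flow_vertices n (\<lambda>i. real (a i)) =
           (k + 1) ^ (c k - 1) * (\<Prod>i = 1..k - 1. (i + 1) ^ c i)"
proof -
  let ?A = "{i. real (a i) \<noteq> 0}"
  have sgn: "(\<forall>l \<in> set (flow_sgn n a). 1 \<le> l) \<and> zero_one_vector n a = block_concat (flow_sgn n a)"
    unfolding flow_sgn_def by (rule theI'[OF flow_sgn_ex1[where n = n and a = a, OF assms(1,2)]])
  then have c: "1 \<le> c i" if "i \<in> {1..k}" for i
  proof -
    have "c i \<in> set (flow_sgn n a)"
      using that unfolding assms(3) by (simp del: upt_Suc)
    with sgn show ?thesis by blast
  qed
  have "zero_one_vector n a \<noteq> []"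
    using assms(1) by (simp add: zero_one_vector_def)
  then have "1 \<le> k"
    using sgn by (cases k) (auto simp: assms(3) block_concat_def)
  have "map (\<lambda>i. if i \<in> ?A then 1 else 0) [1..<n + 1] = zero_one_vector n a"
    by (simp add: zero_one_vector_def)
  also have "\<dots> = block_concat (map c [1..<k + 1])"
    using sgn assms(3) by simp
  finally have scan: "foldl scan_step (0, 1) (map (\<lambda>i. if i \<in> ?A then 1 else 0) [1..<n + 1]) =
      (k, \<Prod>i = 1..k. (i + 1) ^ (c i - 1))"
    using foldl_scan_step_block_concat by metis
  have "num_flow_vertices n (\<lambda>i. real (a i)) = card (routings n ?A {n + 1})"
    by (rule num_flow_vertices_eq_card_routings) simp
  \<comment> \<open>There is one actual sink, \<open>n + 1\<close>, and the rising factorial of 1 of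
    length \<open>k\<close> is \<open>fact k\<close>.\<close>
  also have "\<dots> = (\<Prod>i = 1..k. (i + 1) ^ (c i - 1)) * fact k"
    using card_routings[OF _ _ scan, of "{n + 1}"] by (simp add: pochhammer_fact)
  also have "\<dots> = (k + 1) ^ (c k - 1) * (\<Prod>i = 1..k - 1. (i + 1) ^ c i)"
    using block_product[OF \<open>1 \<le> k\<close> c] by simp
  finally show ?thesis .
qed

end
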